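(* Let $A(z)=\prod_{j=1}^{n}(z-\alpha_j)^{m_j}$, where $\alpha_1,\dots,\alpha_n\in\mathbb{C}$ are distinct, the $m_j$ are positive integers, and $N=\sum_{j=1}^n m_j\geq 1$. Fix $K\in\mathbb{N}$. Then there is a constant $C>0$, depending only on $A$ and $K$, such that for every $\delta>0$ and every polynomial $B\in\mathscr{P}_K$ satisfying (a) $\|B\|\leq 1$, and (b) $|B(\alpha_j)|\geq\delta>0$ for all $1\leq j\leq n$, the minimal solutions $R,S$ of the Bézout equation $A(z)R(z)+B(z)S(z)=1$ ($z\in\mathbb{C}$) satisfy $$\left(\|R\|^2+\|S\|^2\right)^{1/2}\leq \frac{C}{\delta^{\max_j m_j}}.$$
   Context: $\mathscr{P}_K=\{p\in\mathbb{C}[z]:\deg p\leq K\}$. For a polynomial $p(z)=\sum_{j=0}^{n}p_jz^j$, $\|p\|:=\max_{0\leq j\leq n}|p_j|$. If $A,B\in\mathbb{C}[z]$ have no common roots and are not both constant, there are unique polynomials $R,S\in\mathbb{C}[z]$ with $\deg R\leq\deg B-1$, $\deg S\leq\deg A-1$ and $AR+BS\equiv 1$ (a polynomial of degree $\leq -1$ means the zero polynomial). These are called the minimal solutions of the Bézout equation. *)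

theory Defs
  imports
    "HOL-Analysis.Analysis"
    "HOL-Computational_Algebra.Computational_Algebra"
    "HOL-Computational_Algebra.Field_as_Ring"
begin

definition polys_deg_le :: "nat \<Rightarrow> complex poly set" where
  "polys_deg_le K = {p. degree p \<le> K}"

definition coeff_norm :: "complex poly \<Rightarrow> real" where
  "coeff_norm p = Max ((\<lambda>j. cmod (coeff p j)) ` {0..degree p})"

(* The condition deg R \<le> deg B - 1, where a polynomial of degree \<le> -1 is the zero polynomial,
   is expressed as "R = 0 \<or> degree R < degree B": in the library degree 0 = 0, so the
   zero polynomial has to be admitted separately when deg B = 0. *)
definition minimal_bezout_solutions ::
    "complex poly \<Rightarrow> complex poly \<Rightarrow> complex poly \<Rightarrow> complex poly \<Rightarrow> bool" where
  "minimal_bezout_solutions A B R S \<longleftrightarrow>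
     (R = 0 \<or> degree R < degree B) \<and> (S = 0 \<or> degree S < degree A) \<and> A * R + B * S = 1"

lemma minimal_bezout_solutions_ex:
  assumes nocommon: "\<nexists>z. poly A z = 0 \<and> poly B z = 0"
    and nonconst: "\<not> (degree A = 0 \<and> degree B = 0)"
  shows "\<exists>R S. minimal_bezout_solutions A B R S"
proof -
  have A0: "A \<noteq> 0" and B0: "B \<noteq> 0"
    using nocommon nonconst alg_closed_imp_poly_has_root[of A] alg_closed_imp_poly_has_root[of B]
    by (force, force)
  have "degree (gcd A B) = 0"
  proof (rule ccontr)
    assume "degree (gcd A B) \<noteq> 0"
    then obtain z where "poly (gcd A B) z = 0"
      using alg_closed_imp_poly_has_root[of "gcd A B"] by blast
    then have "poly A z = 0 \<and> poly B z = 0"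
      by (meson dvd_trans gcd_dvd1 gcd_dvd2 poly_eq_0_iff_dvd)
    with nocommon show False by blast
  qed
  then have "is_unit (gcd A B)"
    using A0 is_unit_iff_degree[of "gcd A B"] by simp
  then have "gcd A B = 1" by (simp only: is_unit_gcd_iff)
  then obtain R0 S0 where bez: "A * R0 + B * S0 = 1"
    using bezout_coefficients_fst_snd[of A B] by (metis mult.commute)
  define R where "R = R0 mod B"
  define S where "S = S0 + A * (R0 div B)"
  have "A * R + B * S = A * (R0 div B * B + R0 mod B) + B * S0"
    unfolding R_def S_def by (simp only: algebra_simps)
  then have eq: "A * R + B * S = 1" using bez by simp
  have degR: "R = 0 \<or> degree R < degree B"
    unfolding R_def using B0 degree_mod_less by blast
  have degS: "S = 0 \<or> degree S < degree A"
  proof (rule disjCI)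
    assume S0: "\<not> degree S < degree A"
    show "S = 0"
    proof (rule ccontr)
      assume "S \<noteq> 0"
      then have 1: "degree (B * S) = degree B + degree S" using B0 by (simp add: degree_mult_eq)
      have 2: "B * S = 1 - A * R" using eq by (simp add: algebra_simps)
      show False
      proof (cases "R = 0")
        case True
        then have "degree (B * S) = 0" using 2 by simp
        with 1 S0 nonconst show False by auto
      next
        case False
        with degR have "degree R < degree B" by blast
        moreover have "degree (B * S) \<le> degree A + degree R"
          unfolding 2 by (rule degree_diff_le) (use degree_mult_le[of A R] in auto)
        ultimately show False using 1 S0 by linarith
      qed
    qed
  qed
  show ?thesis using eq degR degS unfolding minimal_bezout_solutions_def by blast
qed

lemma minimal_bezout_solutions_unique:
  assumes sol: "minimal_bezout_solutions A B R S" and sol': "minimal_bezout_solutions A B R' S'"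
    and nonconst: "\<not> (degree A = 0 \<and> degree B = 0)"
  shows "R = R' \<and> S = S'"
proof -
  have eq: "A * R + B * S = 1" "A * R' + B * S' = 1"
    and deg: "R = 0 \<or> degree R < degree B" "R' = 0 \<or> degree R' < degree B"
      "S = 0 \<or> degree S < degree A" "S' = 0 \<or> degree S' < degree A"
    using sol sol' unfolding minimal_bezout_solutions_def by auto
  have small: "p = q" if "d dvd p - q" "p = 0 \<or> degree p < degree d" "q = 0 \<or> degree q < degree d"
    for d p q :: "complex poly"
  proof (rule ccontr)
    assume "p \<noteq> q"
    then have "degree d \<le> degree (p - q)" using that(1) by (simp add: dvd_imp_degree_le)
    moreover have "degree (p - q) < degree d"
      using that(2,3) \<open>p \<noteq> q\<close> by (cases "p = 0"; cases "q = 0") (auto intro: degree_diff_less)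
    ultimately show False by simp
  qed
  have diff: "A * (R - R') = B * (S' - S)" using eq by (simp add: algebra_simps)
  have "R - R' = (A * R + B * S) * (R - R')" using eq by simp
  also have "\<dots> = R * (A * (R - R')) + B * (S * (R - R'))" by (simp add: algebra_simps)
  also have "\<dots> = B * (R * (S' - S) + S * (R - R'))" unfolding diff by (simp add: algebra_simps)
  finally have "B dvd R - R'" by (metis dvd_triv_left)
  then have "R = R'" using small deg by blast
  have "S - S' = (A * R + B * S) * (S - S')" using eq by simp
  also have "\<dots> = A * (R * (S - S')) - S * (B * (S' - S))" by (simp add: algebra_simps)
  also have "\<dots> = A * (R * (S - S') - S * (R - R'))" unfolding diff[symmetric] by (simp add: algebra_simps)
  finally have "A dvd S - S'" by (metis dvd_triv_left)
  then have "S = S'" using small deg by blast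
  with \<open>R = R'\<close> show ?thesis by blast
qed

end

(* Modulo A the polynomial S is the inverse of B, so by the Chinese remainder theorem
   S = (\<Sum>j. E j * T j) mod A, where the idempotents E j depend only on A and T j is an inverse of B
   modulo (z - \<alpha> j)^(m j).  With b = B(\<alpha> j) the polynomial 1 - B/b vanishes at \<alpha> j, so a geometric
   series gives T j = (1/b) * (\<Sum>k<m j. (1 - B/b)^k), of norm O(\<delta>^(-m j)).  Finally
   R = (1 - B * S) div A, and reduction and division by A are linear, hence bounded on
   polynomials of bounded degree. *)
theory Submission
  imports Defs
begin

section \<open>Norm estimates for polynomials, linear maps and local inverses\<close>

definition l1_norm :: "'a::real_normed_field poly \<Rightarrow> real" where
  "l1_norm p = (\<Sum>i\<le>degree p. norm (coeff p i))"

lemma l1_norm_eq: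
  assumes "degree p \<le> n"
  shows "l1_norm p = (\<Sum>i\<le>n. norm (coeff p i))"
  unfolding l1_norm_def
  by (rule sum.mono_neutral_left) (use assms in \<open>auto simp: coeff_eq_0\<close>)

lemma l1_norm_nonneg: "0 \<le> l1_norm p"
  by (simp add: l1_norm_def sum_nonneg)

lemma l1_norm_0 [simp]: "l1_norm 0 = 0"
  by (simp add: l1_norm_def)

lemma l1_norm_const [simp]: "l1_norm [:c:] = norm c"
  by (simp add: l1_norm_def)

lemma l1_norm_1 [simp]: "l1_norm 1 = 1"
  by (simp add: l1_norm_def)

lemma l1_norm_triangle: "l1_norm (p + q) \<le> l1_norm p + l1_norm q"
proof -
  define n where "n = max (degree p) (degree q)"
  have "degree (p + q) \<le> n" "degree p \<le> n" "degree q \<le> n"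
    by (auto simp: n_def degree_add_le_max)
  then show ?thesis
    by (simp add: l1_norm_eq sum.distrib[symmetric] sum_mono norm_triangle_ineq)
qed

lemma l1_norm_smult: "l1_norm (smult c p) = norm c * l1_norm p"
  by (simp add: l1_norm_eq[OF degree_smult_le] l1_norm_def norm_mult sum_distrib_left)

lemma l1_norm_diff: "l1_norm (p - q) \<le> l1_norm p + l1_norm q"
  using l1_norm_triangle[of p "- q"] by (simp add: l1_norm_def)

lemma l1_norm_pCons: "l1_norm (pCons a p) = norm a + l1_norm p"
proof -
  have "l1_norm (pCons a p) = (\<Sum>i\<le>Suc (degree p). norm (coeff (pCons a p) i))"
    by (rule l1_norm_eq) (simp add: degree_pCons_le)
  then show ?thesis by (simp only: sum.atMost_Suc_shift) (simp add: l1_norm_def)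
qed

text \<open>Submultiplicativity is the reason for working with \<open>l1_norm\<close>: the maximum
  norm \<open>coeff_norm\<close> lacks it, as the square of 1 + z shows. Peeling off the constant
  coefficient suffices, because multiplication by z does not change the norm.\<close>

lemma l1_norm_mult: "l1_norm (p * q) \<le> l1_norm p * l1_norm q"
proof (induction p)
  case (pCons a p)
  have "l1_norm (pCons a p * q) \<le> l1_norm (smult a q) + l1_norm (pCons 0 (p * q))"
    unfolding mult_pCons_left by (rule l1_norm_triangle)
  also have "\<dots> \<le> norm a * l1_norm q + l1_norm p * l1_norm q"
    using pCons.IH by (simp add: l1_norm_smult l1_norm_pCons)
  finally show ?case by (simp add: l1_norm_pCons algebra_simps)
qed simp

lemma l1_norm_power: "l1_norm (p ^ k) \<le> l1_norm p ^ k"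
proof (induction k)
  case (Suc k)
  have "l1_norm (p ^ Suc k) \<le> l1_norm p * l1_norm (p ^ k)"
    by (simp add: l1_norm_mult)
  also have "\<dots> \<le> l1_norm p * l1_norm p ^ k"
    using Suc.IH l1_norm_nonneg by (rule mult_left_mono)
  finally show ?case by simp
qed simp

lemma l1_norm_sum: "l1_norm (sum f I) \<le> (\<Sum>i\<in>I. l1_norm (f i))"
proof (induction I rule: infinite_finite_induct)
  case (insert x F)
  then show ?case using l1_norm_triangle[of "f x" "sum f F"] by simp
qed simp_all

lemma norm_poly_le:
  fixes p :: "'a::real_normed_field poly"
  assumes "\<And>i. norm (coeff p i) \<le> 1" "degree p \<le> n"
  shows "norm (poly p z) \<le> (\<Sum>i\<le>n. norm z ^ i)"
proof -
  have "poly p z = (\<Sum>i\<le>n. coeff p i * z ^ i)"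
    unfolding poly_altdef
    by (rule sum.mono_neutral_left) (use assms in \<open>auto simp: coeff_eq_0\<close>)
  also have "norm \<dots> \<le> (\<Sum>i\<le>n. norm (coeff p i) * norm z ^ i)"
    by (rule order_trans[OF norm_sum]) (simp add: norm_mult norm_power)
  also have "\<dots> \<le> (\<Sum>i\<le>n. norm z ^ i)"
    using assms(1) by (intro sum_mono mult_left_le_one_le) auto
  finally show ?thesis .
qed

lemma coeff_le_coeff_norm: "cmod (coeff p i) \<le> coeff_norm p"
proof -
  have *: "cmod (coeff p j) \<le> coeff_norm p" if "j \<le> degree p" for j
    unfolding coeff_norm_def by (rule Max_ge) (use that in auto)
  show ?thesis
    using *[of i] *[of 0] by (cases "i \<le> degree p") (auto simp: coeff_eq_0 intro: order_trans[OF norm_ge_zero])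
qed

lemma coeff_norm_le_l1_norm: "coeff_norm p \<le> l1_norm p"
  unfolding coeff_norm_def l1_norm_def
  by (subst Max_le_iff) (auto intro!: member_le_sum)

text \<open>A linear map is determined up to degree \<open>d\<close> by its values on finitely many
  monomials, so the sum of the norms of these values serves as \<open>M\<close>. It is meant for
  remainder and quotient by a fixed polynomial.\<close>

lemma linear_l1_bounded:
  fixes f :: "'a::real_normed_field poly \<Rightarrow> 'a poly"
  assumes add: "\<And>p q. f (p + q) = f p + f q"
    and smult: "\<And>c p. f (smult c p) = smult c (f p)"
  obtains M where "M \<ge> 0" "\<And>p. degree p \<le> d \<Longrightarrow> l1_norm (f p) \<le> M * l1_norm p"
proof
  define M where "M = (\<Sum>i\<le>d. l1_norm (f (monom 1 i)))"
  show "M \<ge> 0" by (simp add: M_def sum_nonneg l1_norm_nonneg)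
  fix p :: "'a poly" assume deg: "degree p \<le> d"
  have f0: "f 0 = 0" using smult[of 0 0] by simp
  have f_sum: "f (sum g I) = (\<Sum>i\<in>I. f (g i))" if "finite I" for g and I :: "nat set"
    using that by induction (simp_all add: f0 add)
  have "p = (\<Sum>i\<le>d. smult (coeff p i) (monom 1 i))"
    using poly_as_sum_of_monoms'[OF deg] by (simp add: smult_monom)
  then have "f p = (\<Sum>i\<le>d. smult (coeff p i) (f (monom 1 i)))"
    using f_sum[of "{..d}" "\<lambda>i. smult (coeff p i) (monom 1 i)"] by (simp add: smult)
  then have "l1_norm (f p) \<le> (\<Sum>i\<le>d. norm (coeff p i) * l1_norm (f (monom 1 i)))"
    using l1_norm_sum[of "\<lambda>i. smult (coeff p i) (f (monom 1 i))" "{..d}"]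
    by (simp add: l1_norm_smult)
  also have "\<dots> \<le> (\<Sum>i\<le>d. l1_norm p * l1_norm (f (monom 1 i)))"
    unfolding l1_norm_eq[OF deg]
    by (intro sum_mono mult_right_mono l1_norm_nonneg member_le_sum) auto
  finally show "l1_norm (f p) \<le> M * l1_norm p"
    by (simp add: M_def sum_distrib_left mult.commute)
qed

text \<open>The number \<open>G\<close> has three tasks: it bounds the numerator of Q = (b - B)/b,
  \<open>1 \<le> G\<close> gives 1/\<delta> \<le> G/\<delta>, and \<open>\<delta> \<le> G\<close>
  makes the powers of G/\<delta> increase with the exponent.\<close>

lemma inverse_mod_linear_power:
  fixes B :: "'a::real_normed_field poly"
  assumes "\<delta> > 0" "\<delta> \<le> norm (poly B a)" and G: "1 \<le> G" "\<delta> \<le> G" "norm (poly B a) + l1_norm B \<le> G"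
  obtains T where "[:- a, 1:] ^ m dvd B * T - 1" "degree T \<le> degree B * m"
    "l1_norm T \<le> real m * (G / \<delta>) ^ m"
proof
  define b where "b = poly B a"
  define Q where "Q = smult (1 / b) ([:b:] - B)"
  define T where "T = smult (1 / b) (\<Sum>k<m. Q ^ k)"
  have b: "b \<noteq> 0" "\<delta> \<le> norm b" using assms by (auto simp: b_def)
  have "B = smult b (1 - Q)"
    using b by (simp add: Q_def smult_diff_right)
  then have "B * T = (1 - Q) * (\<Sum>k<m. Q ^ k)"
    using b by (simp add: T_def)
  \<comment> \<open>The geometric sum telescopes, so the error is exactly a power of
    \<open>Q\<close>, and \<open>Q\<close> vanishes at \<open>a\<close>.\<close>
  then have BT: "B * T - 1 = - (Q ^ m)"
    by (simp add: one_diff_power_eq[symmetric])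
  have "[:- a, 1:] dvd Q"
    by (simp add: Q_def b_def poly_eq_0_iff_dvd[symmetric])
  then show "[:- a, 1:] ^ m dvd B * T - 1"
    unfolding BT by (simp add: dvd_power_same)
  have "degree Q \<le> degree B"
    unfolding Q_def by (rule order_trans[OF degree_smult_le]) (simp add: degree_diff_le)
  then have "degree (Q ^ k) \<le> degree B * m" if "k < m" for k
    by (rule order_trans[OF degree_power_le, OF mult_le_mono]) (use that in simp)
  then show "degree T \<le> degree B * m"
    unfolding T_def by (intro order_trans[OF degree_smult_le] degree_sum_le) auto
  have G\<delta>: "G / \<delta> \<ge> 1" using assms by simp
  have inv: "norm (1 / b) \<le> 1 / \<delta>"
    using b assms by (simp add: norm_divide frac_le)
  have "l1_norm Q \<le> 1 / \<delta> * G"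
    unfolding Q_def l1_norm_smult
    by (intro mult_mono inv order_trans[OF l1_norm_diff] l1_norm_nonneg)
      (use assms in \<open>auto simp: b_def\<close>)
  then have Q: "l1_norm (Q ^ k) \<le> (G / \<delta>) ^ k" for k
    by (intro order_trans[OF l1_norm_power] power_mono l1_norm_nonneg) simp
  have "l1_norm T \<le> (\<Sum>k<m. 1 / \<delta> * l1_norm (Q ^ k))"
    unfolding T_def l1_norm_smult sum_distrib_left[symmetric]
    by (intro mult_mono inv l1_norm_sum l1_norm_nonneg) (use assms in auto)
  also have "\<dots> \<le> (\<Sum>k<m. (G / \<delta>) ^ m)"
  proof (rule sum_mono)
    fix k assume "k \<in> {..<m}"
    \<comment> \<open>The prefactor 1/\<delta> counts as one more factor G/\<delta>; the exponent
      \<open>Suc k\<close> is still at most \<open>m\<close>.\<close>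
    have "1 / \<delta> * l1_norm (Q ^ k) \<le> G / \<delta> * (G / \<delta>) ^ k"
      using assms by (intro mult_mono Q l1_norm_nonneg divide_right_mono) auto
    also have "\<dots> \<le> (G / \<delta>) ^ m"
      using power_increasing[OF _ G\<delta>, of "Suc k" m] \<open>k \<in> {..<m}\<close> by simp
    finally show "1 / \<delta> * l1_norm (Q ^ k) \<le> (G / \<delta>) ^ m" .
  qed
  finally show "l1_norm T \<le> real m * (G / \<delta>) ^ m" by simp
qed

section \<open>Chinese remainder theorem and the recovery of the minimal solutions\<close>

lemma coprime_linear_powers:
  fixes a b :: complex
  assumes "a \<noteq> b"
  shows "coprime ([:- a, 1:] ^ k) ([:- b, 1:] ^ l)"
proof -
  have "coprime [:- a, 1:] [:- b, 1:]"
  proof (rule coprimeI)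
    fix d assume "d dvd [:- a, 1:]" "d dvd [:- b, 1:]"
    then have "d dvd [:- a, 1:] - [:- b, 1:]" by (rule dvd_diff)
    then have "d dvd [:b - a:]" by simp
    moreover have "is_unit [:b - a:]" using assms by (simp add: is_unit_const_poly_iff dvd_field_iff)
    ultimately show "is_unit d" by (rule dvd_trans)
  qed
  then show ?thesis by simp
qed

text \<open>With P the product of the other moduli, a Bezout relation u * q i + v * P = 1 yields the
  witness v * P. Its degree need not be controlled, since it will not depend on B.\<close>

lemma crt_idempotent:
  fixes q :: "'i \<Rightarrow> complex poly"
  assumes "finite I" "i \<in> I" and cop: "\<And>j. j \<in> I \<Longrightarrow> j \<noteq> i \<Longrightarrow> coprime (q i) (q j)"
  shows "\<exists>E. q i dvd E - 1 \<and> (\<forall>j\<in>I. j \<noteq> i \<longrightarrow> q j dvd E)"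
proof -
  define P where "P = (\<Prod>j\<in>I - {i}. q j)"
  have "coprime (q i) P"
    unfolding P_def by (rule prod_coprime_right) (use cop in auto)
  then obtain u v where uv: "u * q i + v * P = 1"
    using bezout_coefficients_fst_snd[of "q i" P] by auto
  have "v * P - 1 = q i * (- u)" unfolding uv[symmetric] by (simp add: algebra_simps)
  moreover have "q j dvd v * P" if "j \<in> I" "j \<noteq> i" for j
    unfolding P_def by (rule dvd_mult, rule dvd_prodI) (use that assms in auto)
  ultimately show ?thesis by (metis dvd_triv_left)
qed

lemma pairwise_coprime_prod_dvd:
  fixes q :: "'i \<Rightarrow> 'a::semiring_gcd"
  assumes "finite I" "\<And>i j. i \<in> I \<Longrightarrow> j \<in> I \<Longrightarrow> i \<noteq> j \<Longrightarrow> coprime (q i) (q j)"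
    and "\<And>i. i \<in> I \<Longrightarrow> q i dvd x"
  shows "(\<Prod>i\<in>I. q i) dvd x"
  using assms
proof (induction I)
  case (insert i I)
  have "coprime (q i) (\<Prod>j\<in>I. q j)"
    by (rule prod_coprime_right) (use insert in auto)
  then show ?case
    using insert by (simp add: divides_mult)
qed simp

text \<open>Modulo a fixed \<open>q i\<close> only the i-th summand survives, and it reduces to
  \<open>T i\<close>, an inverse of \<open>B\<close> there. Pairwise coprimality then combines the
  moduli.\<close>

lemma crt_inverse:
  fixes q E T :: "'i \<Rightarrow> complex poly"
  assumes "finite I"
    and cop: "\<And>i j. i \<in> I \<Longrightarrow> j \<in> I \<Longrightarrow> i \<noteq> j \<Longrightarrow> coprime (q i) (q j)"
    and E: "\<And>i. i \<in> I \<Longrightarrow> q i dvd E i - 1" "\<And>i j. i \<in> I \<Longrightarrow> j \<in> I \<Longrightarrow> j \<noteq> i \<Longrightarrow> q j dvd E i"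
    and T: "\<And>i. i \<in> I \<Longrightarrow> q i dvd B * T i - 1"
  shows "(\<Prod>i\<in>I. q i) dvd B * (\<Sum>i\<in>I. E i * T i) - 1"
proof (rule pairwise_coprime_prod_dvd)
  fix i assume i: "i \<in> I"
  have "(\<Sum>j\<in>I. E j * T j) = E i * T i + (\<Sum>j\<in>I - {i}. E j * T j)"
    using assms(1) i by (rule sum.remove)
  then have "B * (\<Sum>j\<in>I. E j * T j) - 1
      = (E i - 1) * (B * T i) + (B * T i - 1) + B * (\<Sum>j\<in>I - {i}. E j * T j)"
    by (simp add: algebra_simps)
  moreover have "q i dvd (\<Sum>j\<in>I - {i}. E j * T j)"
    by (rule dvd_sum) (use E(2) i in auto)
  ultimately show "q i dvd B * (\<Sum>j\<in>I. E j * T j) - 1"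
    using E(1)[OF i] T[OF i] by (simp only: dvd_add dvd_mult dvd_mult2)
qed (use assms(1) cop in auto)

text \<open>Both \<open>S\<close> and \<open>W\<close> invert \<open>B\<close> modulo
  \<open>A\<close>, hence are congruent, and the degree condition makes \<open>S\<close> the
  remainder. The Bezout equation then gives \<open>R\<close> by an exact division.\<close>

lemma minimal_bezout_solutions_mod_div:
  assumes sol: "minimal_bezout_solutions A B R S" and W: "A dvd B * W - 1" and "A \<noteq> 0"
  shows "S = W mod A" "R = (1 - B * S) div A"
proof -
  have eq: "A * R + B * S = 1" and deg: "S = 0 \<or> degree S < degree A"
    using sol by (auto simp: minimal_bezout_solutions_def)
  then have AR: "A * R = 1 - B * S" by (simp add: algebra_simps)
  then show "R = (1 - B * S) div A" using \<open>A \<noteq> 0\<close> by (metis nonzero_mult_div_cancel_left)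
  \<comment> \<open>Obtained by multiplying \<open>W\<close> by 1 = A * R + B * S.\<close>
  have "W - S = W * (A * R) + S * (B * W - 1)"
    unfolding AR by (simp add: algebra_simps)
  then have "A dvd W - S" using W by simp
  then have "W mod A = S mod A" by (simp add: mod_eq_dvd_iff)
  then show "S = W mod A" using deg mod_poly_less[of S A] by auto
qed

section \<open>Choice of the uniform constant and the final estimate\<close>

theorem theorem1p5:
  fixes n K :: nat and \<alpha> :: "nat \<Rightarrow> complex" and m :: "nat \<Rightarrow> nat" and A :: "complex poly"
  assumes "inj_on \<alpha> {1..n}"
    and "\<And>j. j \<in> {1..n} \<Longrightarrow> m j > 0"
    and "(\<Sum>j=1..n. m j) \<ge> 1"
    and "A = (\<Prod>j=1..n. [:- \<alpha> j, 1:] ^ m j)"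
  shows "\<exists>C::real. C > 0 \<and>
    (\<forall>\<delta>::real. \<forall>B R S :: complex poly.
       \<delta> > 0 \<longrightarrow> B \<in> polys_deg_le K \<longrightarrow> coeff_norm B \<le> 1 \<longrightarrow>
       (\<forall>j\<in>{1..n}. cmod (poly B (\<alpha> j)) \<ge> \<delta>) \<longrightarrow>
       minimal_bezout_solutions A B R S \<longrightarrow>
       sqrt ((coeff_norm R)\<^sup>2 + (coeff_norm S)\<^sup>2) \<le> C / \<delta> ^ Max (m ` {1..n}))"
proof -
  define q where "q j = [:- \<alpha> j, 1:] ^ m j" for j
  define \<mu> where "\<mu> = Max (m ` {1..n})"
  have m_le: "m j \<le> \<mu>" if "j \<in> {1..n}" for j
    unfolding \<mu>_def by (rule Max_ge) (use that in auto)
  have n1: "1 \<in> {1..n}" using assms(3) by (cases n) auto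
  have cop: "coprime (q i) (q j)" if "i \<in> {1..n}" "j \<in> {1..n}" "i \<noteq> j" for i j
    unfolding q_def by (rule coprime_linear_powers) (use assms(1) that in \<open>auto dest: inj_onD\<close>)
  have "\<exists>E. q i dvd E - 1 \<and> (\<forall>j\<in>{1..n}. j \<noteq> i \<longrightarrow> q j dvd E)" if "i \<in> {1..n}" for i
    using that cop by (intro crt_idempotent) auto
  then obtain E where E: "\<And>i. i \<in> {1..n} \<Longrightarrow> q i dvd E i - 1"
      "\<And>i j. i \<in> {1..n} \<Longrightarrow> j \<in> {1..n} \<Longrightarrow> j \<noteq> i \<Longrightarrow> q j dvd E i"
    by metis
  have A0: "A \<noteq> 0" by (simp add: assms(4))
  \<comment> \<open>A degree bound for every possible sum of the E j * T j, depending on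
    \<open>A\<close> and \<open>K\<close> alone.\<close>
  define d where "d = (\<Sum>i=1..n. degree (E i) + K * m i)"
  obtain M1 where M1: "M1 \<ge> 0" "\<And>p. degree p \<le> d \<Longrightarrow> l1_norm (p mod A) \<le> M1 * l1_norm p"
    by (rule linear_l1_bounded[of "\<lambda>p. p mod A" d]) (auto simp: poly_mod_add_left mod_smult_left)
  \<comment> \<open>The bound \<open>K + degree A\<close> is that of 1 - B * S, to which the
    quotient map will be applied.\<close>
  obtain M2 where M2: "M2 \<ge> 0"
      "\<And>p. degree p \<le> K + degree A \<Longrightarrow> l1_norm (p div A) \<le> M2 * l1_norm p"
    by (rule linear_l1_bounded[of "\<lambda>p. p div A" "K + degree A"])
      (auto simp: poly_div_add_left div_smult_left)
  \<comment> \<open>An admissible B has at most K + 1 coefficients, each of modulus at most 1. So 1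
    + K bounds its \<open>l1_norm\<close>, and the double sum bounds its value at every
    root.\<close>
  define G where "G = 1 + real K + (\<Sum>j=1..n. \<Sum>i\<le>K. cmod (\<alpha> j) ^ i)"
  have G1: "G \<ge> 1 + real K" by (simp add: G_def sum_nonneg)
  \<comment> \<open>\<open>C1\<close> will bound S = W mod A, and \<open>C2\<close> will bound R =
    (1 - B * S) div A, each up to the factor (G/\<delta>)^\<mu>.\<close>
  define C1 where "C1 = M1 * (\<Sum>j=1..n. l1_norm (E j) * real (m j))"
  have C1: "C1 \<ge> 0" using M1 by (simp add: C1_def sum_nonneg l1_norm_nonneg)
  define C2 where "C2 = M2 * (1 + (1 + real K) * C1)"
  have C2: "C2 \<ge> 0" using M2 C1 by (simp add: C2_def)
  \<comment> \<open>The summand 1 ensures positivity, as \<open>C1\<close> and \<open>C2\<close> are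
    only known to be nonnegative; the power of \<open>G\<close> is the numerator of
    (G/\<delta>)^\<mu>.\<close>
  define C where "C = (1 + C1 + C2) * G ^ \<mu>"
  have "C > 0" using C1 C2 G1 by (simp add: C_def)
  moreover have "sqrt ((coeff_norm R)\<^sup>2 + (coeff_norm S)\<^sup>2) \<le> C / \<delta> ^ \<mu>"
    if \<delta>: "\<delta> > 0" and degB: "degree B \<le> K" and B1: "coeff_norm B \<le> 1"
      and B\<delta>: "\<And>j. j \<in> {1..n} \<Longrightarrow> cmod (poly B (\<alpha> j)) \<ge> \<delta>"
      and sol: "minimal_bezout_solutions A B R S" for \<delta> :: real and B R S
  proof -
    have coeffB: "cmod (coeff B i) \<le> 1" for i
      using coeff_le_coeff_norm B1 by (rule order_trans)
    have "l1_norm B \<le> (\<Sum>i\<le>K. 1)"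
      unfolding l1_norm_eq[OF degB] by (intro sum_mono coeffB)
    then have l1B: "l1_norm B \<le> 1 + real K" by simp
    have polyB: "cmod (poly B (\<alpha> j)) + l1_norm B \<le> G" if j: "j \<in> {1..n}" for j
    proof -
      have "cmod (poly B (\<alpha> j)) \<le> (\<Sum>i\<le>K. cmod (\<alpha> j) ^ i)"
        by (rule norm_poly_le[OF coeffB degB])
      also have "\<dots> \<le> (\<Sum>j=1..n. \<Sum>i\<le>K. cmod (\<alpha> j) ^ i)"
        using j by (intro member_le_sum) (auto simp: sum_nonneg)
      finally show ?thesis using l1B by (simp add: G_def)
    qed
    \<comment> \<open>Large \<delta> cannot occur: the value of B at the first root lies between
      \<delta> and \<open>G\<close> in modulus. Hence G/\<delta> \<ge> 1, and every exponent
      \<open>m j\<close> may be raised to \<mu>.\<close>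
    have \<delta>G: "\<delta> \<le> G" using B\<delta>[OF n1] polyB[OF n1] l1_norm_nonneg[of B] by linarith
    define X where "X = (G / \<delta>) ^ \<mu>"
    have X1: "X \<ge> 1" unfolding X_def using \<delta> \<delta>G by (intro one_le_power) simp
    have "\<exists>T. q j dvd B * T - 1 \<and> degree T \<le> K * m j \<and> l1_norm T \<le> real (m j) * X"
      if j: "j \<in> {1..n}" for j
    proof -
      obtain T where T: "q j dvd B * T - 1" "degree T \<le> degree B * m j"
          "l1_norm T \<le> real (m j) * (G / \<delta>) ^ m j"
        unfolding q_def
        by (rule inverse_mod_linear_power[OF \<delta> B\<delta>[OF j] _ \<delta>G polyB[OF j], of "m j"]) (use G1 in auto)
      have "(G / \<delta>) ^ m j \<le> X"
        unfolding X_def using \<delta> \<delta>G m_le[OF j] by (intro power_increasing) auto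
      then have "l1_norm T \<le> real (m j) * X"
        by (intro order_trans[OF T(3)] mult_left_mono) auto
      moreover have "degree T \<le> K * m j"
        using T(2) degB by (meson mult_le_mono1 order_trans)
      ultimately show ?thesis using T(1) by blast
    qed
    then obtain T where T: "\<And>j. j \<in> {1..n} \<Longrightarrow> q j dvd B * T j - 1"
        "\<And>j. j \<in> {1..n} \<Longrightarrow> degree (T j) \<le> K * m j"
        "\<And>j. j \<in> {1..n} \<Longrightarrow> l1_norm (T j) \<le> real (m j) * X"
      by metis
    define W where "W = (\<Sum>j=1..n. E j * T j)"
    have "A dvd B * W - 1"
      unfolding assms(4) W_def q_def[symmetric] by (rule crt_inverse[OF _ cop E T(1)]) auto
    note RS = minimal_bezout_solutions_mod_div[OF sol this A0]
    have "degree W \<le> d" unfolding W_def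
    proof (rule degree_sum_le)
      fix j assume j: "j \<in> {1..n}"
      have "degree (E j * T j) \<le> degree (E j) + K * m j"
        using degree_mult_le[of "E j" "T j"] T(2)[OF j] by linarith
      also have "\<dots> \<le> d" unfolding d_def using j by (intro member_le_sum) auto
      finally show "degree (E j * T j) \<le> d" .
    qed simp
    then have "l1_norm S \<le> M1 * l1_norm W" unfolding RS(1) by (rule M1(2))
    also have "l1_norm W \<le> (\<Sum>j=1..n. l1_norm (E j) * (real (m j) * X))"
      unfolding W_def
      by (intro order_trans[OF l1_norm_sum] sum_mono order_trans[OF l1_norm_mult] mult_left_mono
          T(3) l1_norm_nonneg)
    finally have S: "l1_norm S \<le> C1 * X"
      using M1(1) by (simp add: C1_def mult_left_mono sum_distrib_right mult.assoc)
    \<comment> \<open>The non-strict inequality also covers S = 0, whose degree is 0 by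
      convention.\<close>
    have "degree S \<le> degree A"
      using sol by (auto simp: minimal_bezout_solutions_def)
    then have "degree (1 - B * S) \<le> K + degree A"
      using degree_mult_le[of B S] degB by (intro degree_diff_le) auto
    then have "l1_norm R \<le> M2 * l1_norm (1 - B * S)" unfolding RS(2) by (rule M2(2))
    also have "l1_norm (1 - B * S) \<le> 1 + (1 + real K) * (C1 * X)"
      using l1_norm_diff[of 1 "B * S"] l1_norm_mult[of B S]
        mult_mono[OF l1B S _ l1_norm_nonneg] by simp
    \<comment> \<open>The constant term 1 is absorbed by X \<ge> 1.\<close>
    also have "\<dots> \<le> (1 + (1 + real K) * C1) * X" using X1 by (simp add: algebra_simps)
    finally have R: "l1_norm R \<le> C2 * X" using M2(1) by (simp add: C2_def mult_left_mono mult.assoc)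
    have nonneg: "0 \<le> coeff_norm p" for p
      using coeff_le_coeff_norm[of p 0] norm_ge_zero order_trans by blast
    have "sqrt ((coeff_norm R)\<^sup>2 + (coeff_norm S)\<^sup>2) \<le> coeff_norm R + coeff_norm S"
      by (intro sqrt_sum_squares_le_sum nonneg)
    also have "\<dots> \<le> C2 * X + C1 * X"
      using R S coeff_norm_le_l1_norm[of R] coeff_norm_le_l1_norm[of S] by linarith
    also have "\<dots> \<le> (1 + C1 + C2) * X" using X1 by (simp add: algebra_simps)
    also have "\<dots> = C / \<delta> ^ \<mu>" by (simp add: C_def X_def power_divide)
    finally show ?thesis .
  qed
  ultimately show ?thesis unfolding \<mu>_def[symmetric] by (auto simp: polys_deg_le_def)
qed

end
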